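(* Let $r\ge 3$ and $s\ge 1$ be integers and consider the group $M_{2rs} = \langle a,b : a^r = b^{2s} = 1,\ bab^{-1} = a^{-1}\rangle$. (a) If $r$ is odd then $$\mathrm{Spec}(\Gamma_{nc}(M_{2rs})) = \left\{ 0^{2sr-s-r-1},\ (-s)^{r-1},\ \left(\frac{s(r-1)\pm s\sqrt{(r-1)(5r-1)}}{2}\right)^1\right\}$$ and $$E(\Gamma_{nc}(M_{2rs})) = s\left((r-1)+\sqrt{(r-1)(5r-1)}\right).$$ (b) If $r$ is even then $$\mathrm{Spec}(\Gamma_{nc}(M_{2rs})) = \left\{ 0^{2sr-2s-\frac{r}{2}-1},\ (-2s)^{\frac{r}{2}-1},\ \left(s\left(\frac{r}{2}-1\right)\pm s\sqrt{\left(\frac{r}{2}-1\right)\left(\frac{5r}{2}-1\right)}\right)^1\right\}$$ and $$E(\Gamma_{nc}(M_{2rs})) = s\left((r-2)+\sqrt{(r-2)(5r-2)}\right).$$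
   Context: For a finite non-abelian group $G$ with center $Z(G)$, the non-commuting graph $\Gamma_{nc}(G)$ is the simple undirected graph with vertex set $G\setminus Z(G)$, in which two vertices $x,y$ are adjacent if and only if $xy \ne yx$. $\mathrm{Spec}(\mathcal{G}) = \{\lambda_1^{k_1},\dots,\lambda_t^{k_t}\}$ means that the eigenvalues of the adjacency matrix of the graph $\mathcal{G}$ are $\lambda_1,\dots,\lambda_t$ with multiplicities $k_1,\dots,k_t$; an entry with $\pm$ and exponent $1$ denotes two eigenvalues, each of multiplicity one. The energy $E(\mathcal{G})$ is the sum of the absolute values of the eigenvalues, counted with multiplicity. *)

theory Defs
  imports
    "HOL-Algebra.Group"
    "HOL-Computational_Algebra.Fundamental_Theorem_Algebra"
    "Jordan_Normal_Form.Char_Poly"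
    "Graph_Theory.Pair_Digraph"
begin

section \<open>Groups given by generators and relations\<close>

datatype 'g letter = Gen 'g | Inv 'g

type_synonym 'g word = "'g letter list"

text \<open>
  A pair \<open>(u, v)\<close> in \<open>R\<close> is the defining relation \<open>u = v\<close>. Free reduction together with
  the defining relations generates the congruence on the free monoid of words in the generators
  and their formal inverses whose quotient is the group \<open>\<langle>X | R\<rangle>\<close>. The set \<open>X\<close> of
  generators is the whole type \<open>'g\<close>.
\<close>

inductive pres_eq :: "('g word \<times> 'g word) set \<Rightarrow> 'g word \<Rightarrow> 'g word \<Rightarrow> bool"
  for R where
  rel: "(u, v) \<in> R \<Longrightarrow> pres_eq R u v"
| Gen_Inv: "pres_eq R [Gen x, Inv x] []"
| Inv_Gen: "pres_eq R [Inv x, Gen x] []"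
| ctxt: "pres_eq R u v \<Longrightarrow> pres_eq R (p @ u @ q) (p @ v @ q)"
| refl: "pres_eq R u u"
| sym: "pres_eq R u v \<Longrightarrow> pres_eq R v u"
| trans: "pres_eq R u v \<Longrightarrow> pres_eq R v w \<Longrightarrow> pres_eq R u w"

definition word_class :: "('g word \<times> 'g word) set \<Rightarrow> 'g word \<Rightarrow> 'g word set" where
  "word_class R u = {v. pres_eq R u v}"

definition presented_group :: "('g word \<times> 'g word) set \<Rightarrow> 'g word set monoid" where
  "presented_group R =
    \<lparr>carrier = range (word_class R),
     mult = (\<lambda>X Y. \<Union>u\<in>X. \<Union>v\<in>Y. word_class R (u @ v)),
     one = word_class R []\<rparr>"

lemma pres_eq_append:
  assumes "pres_eq R u u'" and "pres_eq R v v'"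
  shows "pres_eq R (u @ v) (u' @ v')"
proof (rule pres_eq.trans)
  show "pres_eq R (u @ v) (u' @ v)"
    using pres_eq.ctxt[OF assms(1), of "[]" v] by simp
  show "pres_eq R (u' @ v) (u' @ v')"
    using pres_eq.ctxt[OF assms(2), of u' "[]"] by simp
qed

lemma word_class_eq_iff: "word_class R u = word_class R v \<longleftrightarrow> pres_eq R u v"
proof
  assume "word_class R u = word_class R v"
  then have "v \<in> word_class R u" by (simp add: word_class_def pres_eq.refl)
  then show "pres_eq R u v" by (simp add: word_class_def)
next
  assume "pres_eq R u v"
  then show "word_class R u = word_class R v"
    unfolding word_class_def by (blast intro: pres_eq.sym pres_eq.trans)
qed

lemma presented_group_mult:
  "word_class R u \<otimes>\<^bsub>presented_group R\<^esub> word_class R v = word_class R (u @ v)"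
proof -
  have eq: "word_class R (u' @ v') = word_class R (u @ v)"
    if "u' \<in> word_class R u" "v' \<in> word_class R v" for u' v'
    using that pres_eq_append[of R u u' v v'] word_class_eq_iff[of R "u @ v" "u' @ v'"]
    by (simp add: word_class_def)
  have ne: "u \<in> word_class R u" "v \<in> word_class R v"
    by (simp_all add: word_class_def pres_eq.refl)
  have "(\<Union>u'\<in>word_class R u. \<Union>v'\<in>word_class R v. word_class R (u' @ v')) = word_class R (u @ v)"
    (is "?U = _")
  proof
    show "?U \<subseteq> word_class R (u @ v)"
      by (intro UN_least) (simp only: eq order.refl)
    show "word_class R (u @ v) \<subseteq> ?U"
      using ne by blast
  qed
  then show ?thesis
    by (simp add: presented_group_def)
qed

lemma presented_group_carrier: "carrier (presented_group R) = range (word_class R)"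
  and presented_group_one: "\<one>\<^bsub>presented_group R\<^esub> = word_class R []"
  by (simp_all add: presented_group_def)

primrec inv_letter :: "'g letter \<Rightarrow> 'g letter" where
  "inv_letter (Gen x) = Inv x"
| "inv_letter (Inv x) = Gen x"

lemma pres_eq_inv_word: "pres_eq R (rev (map inv_letter u) @ u) []"
proof (induction u)
  case Nil
  show ?case by (simp add: pres_eq.refl)
next
  case (Cons l u)
  have "pres_eq R [inv_letter l, l] []"
    by (cases l) (auto intro: pres_eq.Gen_Inv pres_eq.Inv_Gen)
  then have "pres_eq R (rev (map inv_letter (l # u)) @ l # u) (rev (map inv_letter u) @ u)"
    using pres_eq.ctxt[of R "[inv_letter l, l]" "[]" "rev (map inv_letter u)" u] by simp
  then show ?case using Cons by (rule pres_eq.trans)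
qed

lemma group_presented_group: "group (presented_group R)"
proof (rule groupI)
  show "\<exists>y\<in>carrier (presented_group R). y \<otimes>\<^bsub>presented_group R\<^esub> x = \<one>\<^bsub>presented_group R\<^esub>"
    if x: "x \<in> carrier (presented_group R)" for x
  proof -
    obtain u where u: "x = word_class R u"
      using x by (auto simp: presented_group_carrier)
    have "word_class R (rev (map inv_letter u)) \<otimes>\<^bsub>presented_group R\<^esub> x = \<one>\<^bsub>presented_group R\<^esub>"
      unfolding u presented_group_mult
      by (simp add: presented_group_one word_class_eq_iff pres_eq_inv_word)
    then show ?thesis by (auto simp: presented_group_carrier)
  qed
qed (auto simp: presented_group_mult presented_group_carrier presented_group_one)

text \<open>The group \<open>M\<^bsub>2rs\<^esub> = \<langle>a, b | a\<^sup>r = b\<^bsup>2s\<^esup> = 1, bab\<^bsup>-1\<^esup> = a\<^bsup>-1\<^esup>\<rangle>\<close>.\<close>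

datatype M_gen = gen_a | gen_b

definition M_rels :: "nat \<Rightarrow> nat \<Rightarrow> (M_gen word \<times> M_gen word) set" where
  "M_rels r s =
    {(replicate r (Gen gen_a), []),
     (replicate (2 * s) (Gen gen_b), []),
     ([Gen gen_b, Gen gen_a, Inv gen_b], [Inv gen_a])}"

definition M_group :: "nat \<Rightarrow> nat \<Rightarrow> M_gen word set monoid" where
  "M_group r s = presented_group (M_rels r s)"


section \<open>Non-commuting graph\<close>

definition group_center :: "('a, 'b) monoid_scheme \<Rightarrow> 'a set" where
  "group_center G =
    {z \<in> carrier G. \<forall>x\<in>carrier G. z \<otimes>\<^bsub>G\<^esub> x = x \<otimes>\<^bsub>G\<^esub> z}"

definition noncommuting_graph :: "('a, 'b) monoid_scheme \<Rightarrow> 'a pair_pre_digraph" where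
  "noncommuting_graph G =
    \<lparr>pverts = carrier G - group_center G,
     parcs = {(x, y). x \<in> carrier G - group_center G \<and> y \<in> carrier G - group_center G \<and>
                      x \<otimes>\<^bsub>G\<^esub> y \<noteq> y \<otimes>\<^bsub>G\<^esub> x}\<rparr>"

lemma pair_graph_noncommuting_graph:
  assumes "finite (carrier G)"
  shows "pair_graph (noncommuting_graph G)"
proof unfold_locales
  show "finite (parcs (noncommuting_graph G))"
    by (rule finite_subset[of _ "carrier G \<times> carrier G"])
       (use assms in \<open>auto simp: noncommuting_graph_def\<close>)
qed (use assms in \<open>auto simp: noncommuting_graph_def symmetric_def sym_def\<close>)


section \<open>Spectrum and energy of a graph\<close>

definition adjacency_mat :: "'a pair_pre_digraph \<Rightarrow> 'a list \<Rightarrow> real mat" where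
  "adjacency_mat \<Gamma> vs =
    mat (length vs) (length vs) (\<lambda>(i, j). if (vs ! i, vs ! j) \<in> parcs \<Gamma> then 1 else 0)"

text \<open>
  The spectrum does not depend on the enumeration of the vertices; see
  \<open>graph_spectrum_eq\<close> below. For an undirected graph the adjacency matrix is real symmetric,
  so all its complex eigenvalues are among the real roots collected here, and algebraic and
  geometric multiplicities agree.
\<close>

definition graph_spectrum :: "'a pair_pre_digraph \<Rightarrow> real multiset" where
  "graph_spectrum \<Gamma> =
    proots (char_poly (adjacency_mat \<Gamma> (SOME vs. distinct vs \<and> set vs = pverts \<Gamma>)))"

definition graph_energy :: "'a pair_pre_digraph \<Rightarrow> real" where
  "graph_energy \<Gamma> = (\<Sum>x\<in>#graph_spectrum \<Gamma>. \<bar>x\<bar>)"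

lemma similar_adjacency_mat:
  assumes vs: "distinct vs" and ws: "distinct ws" and eq: "set vs = set ws"
  shows "similar_mat (adjacency_mat \<Gamma> vs) (adjacency_mat \<Gamma> ws)"
proof -
  define n where "n = length vs"
  have len: "length vs = n" "length ws = n"
    using vs ws eq by (auto simp: n_def distinct_card[symmetric])
  define perm where
    "perm = (\<lambda>(xs :: 'a list) ys. mat n n (\<lambda>(i, j). if xs ! i = ys ! j then 1 else 0 :: real))"
  have pick: "(\<Sum>k = 0..<n. (if x = ys ! k then 1 else 0) * f (ys ! k)) = f x"
    "(\<Sum>k = 0..<n. f (ys ! k) * (if ys ! k = x then 1 else 0)) = f x"
    if "distinct ys" "length ys = n" "x \<in> set ys" for x :: 'a and ys and f :: "'a \<Rightarrow> real"
  proof -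
    have *: "(\<Sum>k = 0..<n. g (ys ! k)) = sum g (set ys)" for g :: "'a \<Rightarrow> real"
      using sum.reindex_bij_betw[OF bij_betw_nth[of ys "{0..<n}" "set ys"], of g] that
      by (simp add: atLeast0LessThan)
    show "(\<Sum>k = 0..<n. (if x = ys ! k then 1 else 0) * f (ys ! k)) = f x"
      "(\<Sum>k = 0..<n. f (ys ! k) * (if ys ! k = x then 1 else 0)) = f x"
      using that(3) *[of "\<lambda>y. (if x = y then 1 else 0) * f y"]
        *[of "\<lambda>y. f y * (if y = x then 1 else 0)"]
      by (simp_all add: if_distrib if_distribR cong: if_cong)
  qed
  have nth: "i < n \<Longrightarrow> vs ! i \<in> set ws" "i < n \<Longrightarrow> ws ! i \<in> set vs" for i
    using len eq nth_mem by metis+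
  have perm_inv: "perm xs ys * perm ys xs = 1\<^sub>m n"
    if "distinct xs" "length xs = n" "distinct ys" "length ys = n" "set xs = set ys" for xs ys :: "'a list"
  proof (rule eq_matI)
    fix i j assume ij: "i < dim_row (1\<^sub>m n)" "j < dim_col (1\<^sub>m n)"
    with that have "xs ! i \<in> set ys" by (metis index_one_mat(2) nth_mem)
    with that pick(1)[of ys "xs ! i" "\<lambda>y. if y = xs ! j then 1 else 0"] ij
    show "(perm xs ys * perm ys xs) $$ (i, j) = 1\<^sub>m n $$ (i, j)"
      by (simp add: perm_def scalar_prod_def nth_eq_iff_index_eq)
  qed (simp_all add: perm_def)
  have conj: "perm vs ws * adjacency_mat \<Gamma> ws * perm ws vs = adjacency_mat \<Gamma> vs"
  proof (rule eq_matI)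
    fix i j
    assume ij: "i < dim_row (adjacency_mat \<Gamma> vs)" "j < dim_col (adjacency_mat \<Gamma> vs)"
    have left: "(perm vs ws * adjacency_mat \<Gamma> ws) $$ (i, k) =
        (if (vs ! i, ws ! k) \<in> parcs \<Gamma> then 1 else 0)" if "k < n" for k
      using pick(1)[of ws "vs ! i" "\<lambda>y. if (y, ws ! k) \<in> parcs \<Gamma> then 1 else 0"]
        ws len nth ij that
      by (simp add: perm_def adjacency_mat_def scalar_prod_def)
    have "(perm vs ws * adjacency_mat \<Gamma> ws * perm ws vs) $$ (i, j) =
        (\<Sum>k = 0..<n. (perm vs ws * adjacency_mat \<Gamma> ws) $$ (i, k) * perm ws vs $$ (k, j))"
      using ij len by (simp add: perm_def adjacency_mat_def scalar_prod_def)
    also have "\<dots> = (\<Sum>k = 0..<n. (if (vs ! i, ws ! k) \<in> parcs \<Gamma> then 1 else 0) *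
                           (if ws ! k = vs ! j then 1 else 0))"
    proof (intro sum.cong HOL.refl)
      fix k assume "k \<in> {0..<n}"
      then have k: "k < n" by simp
      have "perm ws vs $$ (k, j) = (if ws ! k = vs ! j then 1 else 0)"
        using ij len k by (simp add: perm_def adjacency_mat_def)
      then show "(perm vs ws * adjacency_mat \<Gamma> ws) $$ (i, k) * perm ws vs $$ (k, j) =
          (if (vs ! i, ws ! k) \<in> parcs \<Gamma> then 1 else 0) * (if ws ! k = vs ! j then 1 else 0)"
        by (simp only: left[OF k])
    qed
    also have "\<dots> = (if (vs ! i, vs ! j) \<in> parcs \<Gamma> then 1 else 0)"
      using pick(2)[of ws "vs ! j" "\<lambda>y. if (vs ! i, y) \<in> parcs \<Gamma> then 1 else 0"]
        ws len nth ij by (simp add: adjacency_mat_def)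
    finally show "(perm vs ws * adjacency_mat \<Gamma> ws * perm ws vs) $$ (i, j) =
        adjacency_mat \<Gamma> vs $$ (i, j)"
      using ij by (simp add: adjacency_mat_def)
  qed (simp_all add: perm_def adjacency_mat_def len)
  show ?thesis
    by (rule similar_matI[of _ _ "perm vs ws" "perm ws vs" n])
       (use perm_inv[OF vs len(1) ws len(2) eq] perm_inv[OF ws len(2) vs len(1) eq[symmetric]]
          conj in \<open>auto simp: perm_def adjacency_mat_def len\<close>)
qed

lemma graph_spectrum_eq:
  assumes "distinct vs" and "set vs = pverts \<Gamma>"
  shows "graph_spectrum \<Gamma> = proots (char_poly (adjacency_mat \<Gamma> vs))"
proof -
  let ?ws = "SOME vs. distinct vs \<and> set vs = pverts \<Gamma>"
  have "distinct ?ws \<and> set ?ws = pverts \<Gamma>"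
    by (rule someI[of _ vs]) (simp add: assms)
  then show ?thesis
    unfolding graph_spectrum_def
    using char_poly_similar[OF similar_adjacency_mat[of ?ws vs \<Gamma>]] assms by simp
qed

end

theory Submission
  imports Defs "HOL-Number_Theory.Cong"
begin

text \<open>
  Modulo the congruences \<open>i mod r\<close>, \<open>j mod 2s\<close> every element of the group has a unique normal
  form \<open>a\<^sup>i b\<^sup>j\<close>, and \<open>(a\<^sup>i b\<^sup>j) (a\<^bsup>i'\<^esup> b\<^bsup>j'\<^esup>)\<close> has exponents \<open>i \<plusminus> i'\<close> and \<open>j + j'\<close>, with the
  sign given by the parity of \<open>j\<close>. Comparing the two products of two elements leads to
  congruences \<open>2 x = 0\<close> modulo \<open>r\<close>, that is, to divisibility of \<open>x\<close> by \<open>k = r / gcd r 2\<close>. Consequently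
  two non-central elements commute iff both have even \<open>j\<close>, or both have odd \<open>j\<close> and their \<open>i\<close>
  agree modulo \<open>k\<close> (\<open>M_class_eq_iff\<close>, \<open>M_class_commute_iff\<close>, \<open>M_class_center_iff\<close>).

  The non-commuting graph is therefore complete multipartite. With \<open>t = s gcd r 2\<close>, it has \<open>k\<close>
  parts of size \<open>t\<close> and one part of size \<open>(k - 1) t\<close>. This description is uniform in the parity of
  \<open>r\<close>; the two cases of the theorem are \<open>k = r, t = s\<close> and \<open>k = r / 2, t = 2 s\<close>.

  The adjacency matrix of a complete multipartite graph with \<open>p\<close> parts factors through a space of
  dimension \<open>p\<close>, so the identity \<open>det (1 - U V) = det (1 - V U)\<close> reduces its characteristic
  polynomial to a determinant of size \<open>p\<close>. That one is diagonal plus rank one, and the same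
  identity reduces it further to a scalar. For the part sizes above the result is
  \<open>x\<^bsup>n-k-1\<^esup> (x + t)\<^bsup>k-1\<^esup> (x\<^sup>2 - (k - 1) t x - k (k - 1) t\<^sup>2)\<close>
  (\<open>char_poly_balanced_multipartite\<close>). The roots of the quadratic factor are
  \<open>t (k - 1 \<plusminus> \<surd>((k - 1) (5 k - 1))) / 2\<close>. They have opposite signs, so together they contribute
  the square root times \<open>t\<close> to the energy.
\<close>

section \<open>Characteristic polynomial of a complete multipartite graph\<close>


text \<open>
  Sylvester's determinant identity. The block matrix with rows \<open>(1, U)\<close> and \<open>(V, 1)\<close> can be made
  triangular by eliminating either off-diagonal block, and the two eliminations leave the two
  sides as its determinant.
\<close>

lemma det_one_minus_mult_commute:
  fixes U V :: "'a :: idom mat"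
  assumes U: "U \<in> carrier_mat n p" and V: "V \<in> carrier_mat p n"
  shows "det (1\<^sub>m n - U * V) = det (1\<^sub>m p - V * U)"
proof -
  let ?M = "four_block_mat (1\<^sub>m n) U V (1\<^sub>m p)"
  have UV: "U * V \<in> carrier_mat n n" and VU: "V * U \<in> carrier_mat p p"
    using U V by auto
  have carr: "four_block_mat P Q R S \<in> carrier_mat (n + p) (n + p)"
    if "P \<in> carrier_mat n n" "S \<in> carrier_mat p p" for P Q R S :: "'a mat"
    using that by (rule four_block_carrier_mat)
  have cancel: "X - Y + Y = X" "Y + (X - Y) = X"
    if "X \<in> carrier_mat m m" "Y \<in> carrier_mat m m" for X Y :: "'a mat" and m
    using that by (auto intro!: eq_matI)
  have upper: "?M = four_block_mat (1\<^sub>m n - U * V) U (0\<^sub>m p n) (1\<^sub>m p)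
      * four_block_mat (1\<^sub>m n) (0\<^sub>m n p) V (1\<^sub>m p)"
    using U V UV VU
    by (subst mult_four_block_mat[of _ n n _ p _ p _ _ n _ p]) (auto simp: cancel)
  have lower: "?M = four_block_mat (1\<^sub>m n) (0\<^sub>m n p) V (1\<^sub>m p)
      * four_block_mat (1\<^sub>m n) U (0\<^sub>m p n) (1\<^sub>m p - V * U)"
    using U V UV VU
    by (subst mult_four_block_mat[of _ n n _ p _ p _ _ n _ p]) (auto simp: cancel)
  have "det ?M = det (1\<^sub>m n - U * V)"
    unfolding upper using U V minus_carrier_mat[OF UV, of "1\<^sub>m n"]
    by (subst det_mult[OF carr carr])
       (simp_all add: det_four_block_mat_lower_left_zero[of _ n _ p, OF _ _ HOL.refl]
          det_four_block_mat_upper_right_zero[of _ n _ p, OF _ HOL.refl])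
  moreover have "det ?M = det (1\<^sub>m p - V * U)"
    unfolding lower using U V minus_carrier_mat[OF VU, of "1\<^sub>m p"]
    by (subst det_mult[OF carr carr])
       (simp_all add: det_four_block_mat_lower_left_zero[of _ n _ p, OF _ _ HOL.refl]
          det_four_block_mat_upper_right_zero[of _ n _ p, OF _ HOL.refl])
  ultimately show ?thesis by simp
qed

lemma det_mat_diag: "det (mat_diag n f) = (\<Prod>i<n. f i :: 'a :: comm_ring_1)"
  by (subst det_upper_triangular[of _ n])
     (auto simp: prod_list_diag_prod mat_diag_def upper_triangular_def atLeast0LessThan)

text \<open>
  The vertices are \<open>0, \<dots>, n - 1\<close>, and \<open>c\<close> names the part of each vertex; empty parts contribute
  trivial factors. Evaluating at \<open>x > 0\<close> makes all the denominators positive, and a polynomial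
  is determined by its values at positive arguments.
\<close>

lemma poly_char_poly_complete_multipartite:
  fixes x :: real and c :: "nat \<Rightarrow> nat"
  assumes c: "\<And>i. i < n \<Longrightarrow> c i < p" and x: "x > 0"
  defines "m \<equiv> \<lambda>l. real (card {i. i < n \<and> c i = l})"
  shows "poly (char_poly (mat n n (\<lambda>(i, j). if c i \<noteq> c j then 1 else 0))) x =
    x ^ n * (\<Prod>l<p. 1 + m l / x) * (1 - (\<Sum>l<p. m l / (x + m l)))"
    (is "poly (char_poly ?A) x = _")
proof -
  have pos: "x + m l > 0" for l using x by (simp add: m_def add_pos_nonneg)
  \<comment> \<open>\<open>V\<close> is the incidence matrix of parts and vertices, and \<open>x U V\<close> is the adjacency matrix.\<close>
  define U where "U = mat n p (\<lambda>(i, l). if c i \<noteq> l then 1 / x else 0)"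
  define V where "V = mat p n (\<lambda>(l, j). if c j = l then 1 else 0 :: real)"
  define w where "w = mat p 1 (\<lambda>(l, _). m l / (x + m l))"
  define u where "u = mat 1 p (\<lambda>_. 1 :: real)"
  have UV: "x \<cdot>\<^sub>m (1\<^sub>m n - U * V) = - char_matrix ?A x"
  proof (rule eq_matI)
    fix i j assume "i < dim_row (- char_matrix ?A x)" "j < dim_col (- char_matrix ?A x)"
    then have ij: "i < n" "j < n" by (auto simp: char_matrix_def)
    have "(U * V) $$ (i, j) = (\<Sum>l = 0..<p. if l = c j then (if c i \<noteq> l then 1 / x else 0) else 0)"
    proof -
      have "(U * V) $$ (i, j) = (\<Sum>l = 0..<p. U $$ (i, l) * V $$ (l, j))"
        using ij by (simp add: U_def V_def scalar_prod_def)
      also have "\<dots> = (\<Sum>l = 0..<p. if l = c j then (if c i \<noteq> l then 1 / x else 0) else 0)"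
        using ij by (intro sum.cong) (auto simp: U_def V_def)
      finally show ?thesis .
    qed
    also have "\<dots> = (if c i \<noteq> c j then 1 / x else 0)"
      using c ij by simp
    finally show "(x \<cdot>\<^sub>m (1\<^sub>m n - U * V)) $$ (i, j) = (- char_matrix ?A x) $$ (i, j)"
      using ij x by (auto simp: char_matrix_def U_def V_def)
  qed (auto simp: U_def V_def char_matrix_def)
  \<comment> \<open>After factoring out the diagonal, what remains is the identity minus a matrix of rank one.\<close>
  have VU: "1\<^sub>m p - V * U = mat_diag p (\<lambda>l. 1 + m l / x) * (1\<^sub>m p - w * u)"
  proof (rule eq_matI)
    fix l l' assume "l < dim_row (mat_diag p (\<lambda>l. 1 + m l / x) * (1\<^sub>m p - w * u))"
      "l' < dim_col (mat_diag p (\<lambda>l. 1 + m l / x) * (1\<^sub>m p - w * u))"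
    then have l: "l < p" "l' < p" by (auto simp: u_def w_def mat_diag_def)
    have "(V * U) $$ (l, l') = (\<Sum>j = 0..<n. if c j = l then (if l \<noteq> l' then 1 / x else 0) else 0)"
    proof -
      have "(V * U) $$ (l, l') = (\<Sum>j = 0..<n. V $$ (l, j) * U $$ (j, l'))"
        using l by (simp add: U_def V_def scalar_prod_def)
      also have "\<dots> = (\<Sum>j = 0..<n. if c j = l then (if l \<noteq> l' then 1 / x else 0) else 0)"
        using l by (intro sum.cong) (auto simp: U_def V_def)
      finally show ?thesis .
    qed
    also have "\<dots> = (if l \<noteq> l' then m l / x else 0)"
      by (simp add: sum.If_cases m_def Int_def conj_commute)
    finally have lhs: "(1\<^sub>m p - V * U) $$ (l, l') = (if l = l' then 1 else - m l / x)"
      using l by (auto simp: U_def V_def)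
    have "(w * u) $$ (l, l') = m l / (x + m l)"
      using l by (simp add: w_def u_def scalar_prod_def)
    then have "(mat_diag p (\<lambda>l. 1 + m l / x) * (1\<^sub>m p - w * u)) $$ (l, l')
        = (1 + m l / x) * ((if l = l' then 1 else 0) - m l / (x + m l))"
      using l by (subst mat_diag_mult_left[of _ p p]) (auto simp: w_def u_def)
    also have "\<dots> = (if l = l' then 1 else - m l / x)"
    proof -
      have "1 - m l / (x + m l) = x / (x + m l)" "1 + m l / x = (x + m l) / x"
        using x pos[of l] by (simp_all add: field_simps)
      then show ?thesis using x pos[of l] by (cases "l = l'") simp_all
    qed
    finally show "(1\<^sub>m p - V * U) $$ (l, l')
        = (mat_diag p (\<lambda>l. 1 + m l / x) * (1\<^sub>m p - w * u)) $$ (l, l')"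
      using lhs by simp
  qed (auto simp: U_def V_def u_def w_def mat_diag_def)
  have wu: "det (1\<^sub>m p - w * u) = 1 - (\<Sum>l<p. m l / (x + m l))"
  proof -
    have "det (1\<^sub>m p - w * u) = det (1\<^sub>m 1 - u * w)"
      by (rule det_one_minus_mult_commute) (simp_all add: w_def u_def)
    also have "\<dots> = (1\<^sub>m 1 - u * w) $$ (0, 0)"
      by (intro det_single minus_carrier_mat mult_carrier_mat[of _ 1 p]) (simp_all add: w_def u_def)
    also have "\<dots> = 1 - (\<Sum>l<p. m l / (x + m l))"
      by (simp add: w_def u_def scalar_prod_def atLeast0LessThan)
    finally show ?thesis .
  qed
  have "poly (char_poly ?A) x = det (x \<cdot>\<^sub>m (1\<^sub>m n - U * V))"
    by (simp only: UV) (rule char_poly_matrix[of _ n], simp)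
  also have "\<dots> = x ^ n * det (1\<^sub>m p - V * U)"
    by (subst det_smult, subst det_one_minus_mult_commute[of _ n p]) (auto simp: U_def V_def)
  also have "det (1\<^sub>m p - V * U) = (\<Prod>l<p. 1 + m l / x) * (1 - (\<Sum>l<p. m l / (x + m l)))"
    unfolding VU wu[symmetric] det_mat_diag[symmetric]
    by (rule det_mult[of _ p]) (auto simp: w_def u_def)
  finally show ?thesis by simp
qed

text \<open>
  With \<open>k\<close> parts of size \<open>t\<close> and one of size \<open>(k - 1) t\<close>, the factors \<open>x + t\<close> of the \<open>k\<close> equal parts
  cancel against the sum up to one common denominator, which leaves the power \<open>k - 1\<close> of \<open>x + t\<close>
  and a quadratic polynomial.
\<close>

lemma char_poly_balanced_multipartite:
  fixes c :: "nat \<Rightarrow> nat" and k t :: nat and D :: real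
  assumes c: "\<And>i. i < n \<Longrightarrow> c i \<le> k" and k: "k \<ge> 2" and t: "t \<ge> 1"
    and small: "\<And>l. l < k \<Longrightarrow> card {i. i < n \<and> c i = l} = t"
    and large: "card {i. i < n \<and> c i = k} = (k - 1) * t"
  defines "D \<equiv> sqrt ((real k - 1) * (5 * real k - 1))"
  shows "char_poly (mat n n (\<lambda>(i, j). if c i \<noteq> c j then 1 else 0)) =
    [:0, 1:] ^ ((2 * k - 1) * t - (k + 1)) * [:real t, 1:] ^ (k - 1) *
    ([:- (real t * (real k - 1 + D) / 2), 1:] * [:- (real t * (real k - 1 - D) / 2), 1:])" (is "?P = ?Q")
proof -
  have "{..<n} = (\<Union>l\<in>{..k}. {i. i < n \<and> c i = l})"
    using c by auto
  then have "card {..<n} = (\<Sum>l\<le>k. card {i. i < n \<and> c i = l})"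
    by (simp only:) (rule card_UN_disjoint, auto)
  then have n: "n = k * t + (k - 1) * t"
    by (simp add: lessThan_Suc_atMost[symmetric] small large)
  have n2: "(2 * k - 1) * t = n"
  proof -
    have "2 * k - 1 = k + (k - 1)" using k by simp
    then show ?thesis by (simp only: n add_mult_distrib)
  qed
  \<comment> \<open>The powers of \<open>x\<close> are natural numbers, so \<open>n \<ge> k + 1\<close> is needed to split \<open>x ^ n\<close>.\<close>
  have "k \<le> k * t" using t by simp
  moreover have "1 \<le> (k - 1) * t" using t k by (simp add: Suc_leI)
  ultimately have n': "n = (n - (k + 1)) + (k + 1)"
    unfolding n by linarith
  define K T where "K = real k" and "T = real t"
  have D: "D\<^sup>2 = (K - 1) * (5 * K - 1)"
    using k by (simp add: D_def K_def)
  have eq: "poly ?P x = poly ?Q x" if x: "x > 0" for x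
  proof -
    define L where "L = x + (K - 1) * T"
    have T: "T > 0" and K: "K > 1" using t k by (auto simp: T_def K_def)
    have L: "L > 0" "x + T > 0" using x T K by (auto simp: L_def add_pos_nonneg)
    have k1: "real (k - Suc 0) = K - 1" using k by (simp add: K_def of_nat_diff)
    have "poly ?P x = x ^ n * ((1 + T / x) ^ k * (1 + (K - 1) * T / x)) *
        (1 - (K * (T / (x + T)) + (K - 1) * T / L))"
      using c by (subst poly_char_poly_complete_multipartite[of n c "Suc k", OF _ x])
        (auto simp: small large k1 T_def[symmetric] K_def[symmetric] L_def less_Suc_eq_le)
    also have "1 + T / x = (x + T) / x" using x by (simp add: field_simps)
    also have "1 + (K - 1) * T / x = L / x" using x by (simp add: L_def field_simps)
    also have "x ^ n = x ^ (n - (k + 1)) * (x ^ k * x)"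
      by (subst n') (simp add: power_add)
    also have "x ^ (n - (k + 1)) * (x ^ k * x) * (((x + T) / x) ^ k * (L / x)) *
        (1 - (K * (T / (x + T)) + (K - 1) * T / L)) =
      x ^ (n - (k + 1)) * ((x + T) ^ k * L * (1 - (K * (T / (x + T)) + (K - 1) * T / L)))"
      using x by (simp add: power_divide)
    also have "(x + T) ^ k = (x + T) ^ (k - 1) * (x + T)"
      using k by (simp add: power_eq_if)
    also have "(x + T) ^ (k - 1) * (x + T) * L * (1 - (K * (T / (x + T)) + (K - 1) * T / L)) =
      (x + T) ^ (k - 1) * ((x + T) * L - (K * T * L + (K - 1) * T * (x + T)))"
    proof -
      have "K * (T / (x + T)) + (K - 1) * T / L = (K * T * L + (K - 1) * T * (x + T)) / ((x + T) * L)"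
        using L by (simp add: add_divide_distrib)
      then have "(x + T) * L * (1 - (K * (T / (x + T)) + (K - 1) * T / L)) =
          (x + T) * L - (K * T * L + (K - 1) * T * (x + T))"
        using L by (simp only: right_diff_distrib) simp
      then show ?thesis by (simp only: mult.assoc)
    qed
    also have "(x + T) * L - (K * T * L + (K - 1) * T * (x + T)) =
        x\<^sup>2 - (K - 1) * T * x - K * (K - 1) * T\<^sup>2"
      by (simp add: L_def power2_eq_square algebra_simps)
    also have "\<dots> = (x - T * (K - 1 + D) / 2) * (x - T * (K - 1 - D) / 2)"
    proof -
      have "(x - T * (K - 1 + D) / 2) * (x - T * (K - 1 - D) / 2) =
        x\<^sup>2 - (K - 1) * T * x + T\<^sup>2 * ((K - 1)\<^sup>2 - D\<^sup>2) / 4"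
        by (simp add: power2_eq_square field_simps)
      also have "\<dots> = x\<^sup>2 - (K - 1) * T * x - K * (K - 1) * T\<^sup>2"
        unfolding D by (simp add: power2_eq_square field_simps)
      finally show ?thesis by simp
    qed
    finally show ?thesis
      unfolding n2 using k by (simp add: poly_power k1 K_def T_def add.commute of_nat_diff
          del: mult_pCons_left mult_pCons_right)
  qed
  show ?thesis
  proof (rule ccontr)
    assume "?P \<noteq> ?Q"
    then have "finite {x. poly (?P - ?Q) x = 0}" by (intro poly_roots_finite) simp
    moreover have "{0<..} \<subseteq> {x. poly (?P - ?Q) x = 0}" using eq by auto
    ultimately show False using infinite_Ioi finite_subset by blast
  qed
qed



section \<open>Normal forms in the group\<close>

text \<open>
  The exponents \<open>(i, j)\<close> of the form \<open>a\<^sup>i b\<^sup>j\<close> that a word takes when only cancellation and the relation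
  \<open>b a b\<^bsup>-1\<^esup> = a\<^bsup>-1\<^esup>\<close> are used to move all letters \<open>b\<^bsup>\<plusminus>1\<^esup>\<close> to the right. This interprets
  words in the semidirect product of two copies of the integers in which odd elements of the
  second copy act on the first by negation.
\<close>

fun M_exps :: "M_gen word \<Rightarrow> int \<times> int" where
  "M_exps [] = (0, 0)"
| "M_exps (Gen gen_a # w) = (fst (M_exps w) + 1, snd (M_exps w))"
| "M_exps (Inv gen_a # w) = (fst (M_exps w) - 1, snd (M_exps w))"
| "M_exps (Gen gen_b # w) = (- fst (M_exps w), snd (M_exps w) + 1)"
| "M_exps (Inv gen_b # w) = (- fst (M_exps w), snd (M_exps w) - 1)"

lemma M_exps_append:
  "M_exps (u @ v) =
    (fst (M_exps u) + (if even (snd (M_exps u)) then 1 else -1) * fst (M_exps v),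
     snd (M_exps u) + snd (M_exps v))"
  by (induction u rule: M_exps.induct) auto

lemma M_exps_replicate:
  "M_exps (replicate i (Gen gen_a)) = (int i, 0)"
  "M_exps (replicate j (Gen gen_b)) = (0, int j)"
  by (induction i, simp_all, induction j, simp_all)

text \<open>
  Uniqueness of the normal form: the defining relations respect the exponents up to the moduli
  \<open>r\<close> and \<open>2 s\<close>. The congruence survives in a context because the modulus \<open>2 s\<close> is even, so that
  congruent second exponents act by the same sign.
\<close>

lemma M_exps_cong:
  assumes "pres_eq (M_rels r s) u v"
  shows "[fst (M_exps u) = fst (M_exps v)] (mod int r) \<and>
    [snd (M_exps u) = snd (M_exps v)] (mod 2 * int s)"
  using assms
proof induction
  case (rel u v)
  then show ?case
    by (auto simp: M_rels_def M_exps_replicate cong_def)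
next
  case (ctxt u v p q)
  have "2 dvd 2 * int s" by simp
  then have "[snd (M_exps u) = snd (M_exps v)] (mod 2)"
    using ctxt.IH cong_dvd_modulus by blast
  then have "even (snd (M_exps u)) \<longleftrightarrow> even (snd (M_exps v))"
    by (simp add: cong_def even_iff_mod_2_eq_zero)
  with ctxt.IH show ?case
    by (auto simp: M_exps_append intro!: cong_add cong_mult cong_diff
        intro: cong_minus_minus_iff[THEN iffD2])
next
  case (Gen_Inv x)
  show ?case by (cases x) auto
next
  case (Inv_Gen x)
  show ?case by (cases x) auto
qed (auto intro: cong_sym cong_trans)

lemma (in group) int_pow_conj_inv:
  fixes i :: int
  assumes [simp]: "a \<in> carrier G" "b \<in> carrier G" and ba: "b \<otimes> a = inv a \<otimes> b"
  shows "b \<otimes> a [^] i = a [^] (- i) \<otimes> b"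
proof (induction i rule: int_induct[of _ 0])
  case base
  show ?case by simp
next
  case (step1 i)
  have "b \<otimes> a [^] (i + 1) = (b \<otimes> a) \<otimes> a [^] i"
    using int_pow_mult[of a 1 i] by (simp add: add.commute m_assoc)
  also have "\<dots> = inv a \<otimes> a [^] (- i) \<otimes> b"
    by (simp add: ba m_assoc step1.IH)
  also have "inv a \<otimes> a [^] (- i) = a [^] (- 1 + - i)"
    by (subst int_pow_mult) (simp_all add: int_pow_neg)
  also have "- 1 + - i = - (i + 1)" by simp
  finally show ?case .
next
  case (step2 i)
  have "b \<otimes> inv a = a \<otimes> b"
  proof -
    have "a \<otimes> b \<otimes> a = b"
      by (simp add: m_assoc ba) (simp add: m_assoc[symmetric])
    then have "b \<otimes> inv a = (a \<otimes> b \<otimes> a) \<otimes> inv a" by simp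
    then show ?thesis by (simp add: m_assoc)
  qed
  then have "b \<otimes> (inv a \<otimes> a [^] i) = a \<otimes> (a [^] (- i) \<otimes> b)"
    using step2.IH by (metis assms(1,2) int_pow_closed inv_closed m_assoc)
  moreover have "inv a \<otimes> a [^] i = a [^] (- 1 + i)"
    by (subst int_pow_mult) (simp_all add: int_pow_neg)
  moreover have "a \<otimes> (a [^] (- i) \<otimes> b) = a [^] (1 + - i) \<otimes> b"
    by (subst int_pow_mult) (simp_all add: m_assoc)
  moreover have "- 1 + i = i - 1" "1 + - i = - (i - 1)" by simp_all
  ultimately show ?case by metis
qed

lemma (in group) int_pow_eq_of_cong:
  fixes i j :: int
  assumes [simp]: "x \<in> carrier G" and x: "x [^] n = \<one>" and ij: "[i = j] (mod int n)"
  shows "x [^] i = x [^] j"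
proof -
  obtain q where "i = int n * q + j"
    using ij by (metis cong_iff_lin cong_sym add.commute mult.commute)
  moreover have "x [^] (int n * q) = \<one>"
    by (simp add: int_pow_pow[symmetric] int_pow_int x)
  ultimately show ?thesis by (simp add: int_pow_mult)
qed

abbreviation M_class :: "nat \<Rightarrow> nat \<Rightarrow> M_gen word \<Rightarrow> M_gen word set" where
  "M_class r s \<equiv> word_class (M_rels r s)"

lemma group_M_group: "group (M_group r s)"
  unfolding M_group_def by (rule group_presented_group)

lemma M_group_carrier: "carrier (M_group r s) = range (M_class r s)"
  and M_group_mult: "M_class r s u \<otimes>\<^bsub>M_group r s\<^esub> M_class r s v = M_class r s (u @ v)"
  and M_group_one: "\<one>\<^bsub>M_group r s\<^esub> = M_class r s []"
  unfolding M_group_def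
  by (simp_all add: presented_group_carrier presented_group_mult presented_group_one)

lemma M_class_replicate:
  "M_class r s (replicate n l) = M_class r s [l] [^]\<^bsub>M_group r s\<^esub> n"
proof -
  interpret group "M_group r s" by (rule group_M_group)
  have "replicate (Suc n) l = replicate n l @ [l]" for n
    by (simp add: replicate_append_same)
  then show ?thesis
    by (induction n) (simp_all add: M_group_one M_group_mult[symmetric] del: replicate_Suc)
qed

text \<open>
  Existence of the normal form. Integer powers are used so that negative exponents, which come
  from inverse letters, need no reduction.
\<close>

lemma M_class_normal_form:
  "M_class r s w = M_class r s [Gen gen_a] [^]\<^bsub>M_group r s\<^esub> fst (M_exps w)
    \<otimes>\<^bsub>M_group r s\<^esub> M_class r s [Gen gen_b] [^]\<^bsub>M_group r s\<^esub> snd (M_exps w)"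
proof -
  define G where "G = M_group r s"
  interpret group G unfolding G_def by (rule group_M_group)
  define a b where "a = M_class r s [Gen gen_a]" and "b = M_class r s [Gen gen_b]"
  have mult: "M_class r s u \<otimes>\<^bsub>G\<^esub> M_class r s v = M_class r s (u @ v)" for u v
    by (simp add: G_def M_group_mult)
  have carr: "M_class r s u \<in> carrier G" for u
    by (simp add: G_def M_group_carrier)
  have ab [simp]: "a \<in> carrier G" "b \<in> carrier G"
    by (simp_all add: a_def b_def carr)
  have inv: "M_class r s [Inv x] = inv\<^bsub>G\<^esub> M_class r s [Gen x]" for x
  proof -
    have "M_class r s [Inv x] \<otimes>\<^bsub>G\<^esub> M_class r s [Gen x] = \<one>\<^bsub>G\<^esub>"
      by (simp add: mult) (simp add: G_def M_group_one word_class_eq_iff pres_eq.Inv_Gen)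
    then show ?thesis by (intro inv_equality[symmetric] carr)
  qed
  have "M_class r s ([Gen gen_b] @ [Gen gen_a] @ [Inv gen_b]) = M_class r s [Inv gen_a]"
    by (auto simp: word_class_eq_iff M_rels_def intro: pres_eq.rel)
  then have "b \<otimes>\<^bsub>G\<^esub> (a \<otimes>\<^bsub>G\<^esub> inv\<^bsub>G\<^esub> b) = inv\<^bsub>G\<^esub> a"
    by (simp only: mult[symmetric] inv a_def b_def)
  then have ba: "b \<otimes>\<^bsub>G\<^esub> a = inv\<^bsub>G\<^esub> a \<otimes>\<^bsub>G\<^esub> b"
    by (metis ab inv_closed m_assoc m_closed r_inv l_inv r_one)
  have b_pow: "b \<otimes>\<^bsub>G\<^esub> a [^]\<^bsub>G\<^esub> i = a [^]\<^bsub>G\<^esub> (- i) \<otimes>\<^bsub>G\<^esub> b" for i :: int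
    by (rule int_pow_conj_inv) (simp_all add: ba)
  have b_inv_pow: "inv\<^bsub>G\<^esub> b \<otimes>\<^bsub>G\<^esub> a [^]\<^bsub>G\<^esub> i = a [^]\<^bsub>G\<^esub> (- i) \<otimes>\<^bsub>G\<^esub> inv\<^bsub>G\<^esub> b" for i :: int
  proof -
    have "inv\<^bsub>G\<^esub> b \<otimes>\<^bsub>G\<^esub> a [^]\<^bsub>G\<^esub> i = inv\<^bsub>G\<^esub> b \<otimes>\<^bsub>G\<^esub> (a [^]\<^bsub>G\<^esub> i \<otimes>\<^bsub>G\<^esub> b) \<otimes>\<^bsub>G\<^esub> inv\<^bsub>G\<^esub> b"
      by (simp add: m_assoc)
    also have "a [^]\<^bsub>G\<^esub> i \<otimes>\<^bsub>G\<^esub> b = b \<otimes>\<^bsub>G\<^esub> a [^]\<^bsub>G\<^esub> (- i)"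
      using b_pow[of "- i"] by simp
    also have "inv\<^bsub>G\<^esub> b \<otimes>\<^bsub>G\<^esub> (b \<otimes>\<^bsub>G\<^esub> a [^]\<^bsub>G\<^esub> (- i)) \<otimes>\<^bsub>G\<^esub> inv\<^bsub>G\<^esub> b = a [^]\<^bsub>G\<^esub> (- i) \<otimes>\<^bsub>G\<^esub> inv\<^bsub>G\<^esub> b"
      by (simp add: m_assoc[symmetric])
    finally show ?thesis .
  qed
  have "M_class r s w = a [^]\<^bsub>G\<^esub> fst (M_exps w) \<otimes>\<^bsub>G\<^esub> b [^]\<^bsub>G\<^esub> snd (M_exps w)"
  proof (induction w rule: M_exps.induct)
    case 1
    have "M_class r s [] = \<one>\<^bsub>G\<^esub>" by (simp add: G_def M_group_one)
    then show ?case by simp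
  next
    case (2 w)
    have "M_class r s (Gen gen_a # w) = a \<otimes>\<^bsub>G\<^esub> M_class r s w"
      by (simp add: a_def mult)
    then show ?case
      using int_pow_mult[of a 1 "fst (M_exps w)"] by (simp add: 2 m_assoc add.commute)
  next
    case (3 w)
    have "M_class r s (Inv gen_a # w) = inv\<^bsub>G\<^esub> a \<otimes>\<^bsub>G\<^esub> M_class r s w"
      by (simp add: a_def mult inv[symmetric])
    then show ?case
      using int_pow_mult[of a "- 1" "fst (M_exps w)"] by (simp add: 3 m_assoc int_pow_neg)
  next
    case (4 w)
    have "M_class r s (Gen gen_b # w) = b \<otimes>\<^bsub>G\<^esub> M_class r s w"
      by (simp add: b_def mult)
    then show ?case
      using int_pow_mult[of b 1 "snd (M_exps w)"] b_pow[of "fst (M_exps w)"]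
      by (simp add: 4 m_assoc add.commute) (simp add: m_assoc[symmetric])
  next
    case (5 w)
    have "M_class r s (Inv gen_b # w) = inv\<^bsub>G\<^esub> b \<otimes>\<^bsub>G\<^esub> M_class r s w"
      by (simp add: b_def mult inv[symmetric])
    then show ?case
      using int_pow_mult[of b "- 1" "snd (M_exps w)"] b_inv_pow[of "fst (M_exps w)"]
      by (simp add: 5 int_pow_neg) (metis ab int_pow_closed inv_closed m_assoc)
  qed
  then show ?thesis by (simp add: a_def b_def G_def)
qed

lemma M_class_eq_iff:
  "M_class r s u = M_class r s v \<longleftrightarrow>
    [fst (M_exps u) = fst (M_exps v)] (mod int r) \<and>
    [snd (M_exps u) = snd (M_exps v)] (mod 2 * int s)"
proof
  assume "M_class r s u = M_class r s v"
  then show "[fst (M_exps u) = fst (M_exps v)] (mod int r) \<and>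
      [snd (M_exps u) = snd (M_exps v)] (mod 2 * int s)"
    by (simp add: word_class_eq_iff M_exps_cong)
next
  interpret group "M_group r s" by (rule group_M_group)
  assume "[fst (M_exps u) = fst (M_exps v)] (mod int r) \<and>
      [snd (M_exps u) = snd (M_exps v)] (mod 2 * int s)"
  moreover have "M_class r s (replicate r (Gen gen_a)) = M_class r s []"
    and "M_class r s (replicate (2 * s) (Gen gen_b)) = M_class r s []"
    unfolding word_class_eq_iff by (rule pres_eq.rel, simp add: M_rels_def)+
  then have "M_class r s [Gen gen_a] [^]\<^bsub>M_group r s\<^esub> r = \<one>\<^bsub>M_group r s\<^esub>"
    and "M_class r s [Gen gen_b] [^]\<^bsub>M_group r s\<^esub> (2 * s) = \<one>\<^bsub>M_group r s\<^esub>"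
    by (simp_all only: M_class_replicate M_group_one)
  ultimately show "M_class r s u = M_class r s v"
    unfolding M_class_normal_form[of r s u] M_class_normal_form[of r s v]
    by (intro arg_cong2[of _ _ _ _ "mult (M_group r s)"] int_pow_eq_of_cong)
       (auto simp: M_group_carrier)
qed

text \<open>
  For the energy, the only eigenvalues whose sign is not visible are the last two. From
  \<open>(k - 1)\<^sup>2 \<le> (k - 1) (5 k - 1)\<close> follows \<open>k - 1 \<le> D\<close>, so their absolute values add up to \<open>t D\<close>.
\<close>

lemma
  fixes \<Gamma> :: "'a pair_pre_digraph" and c :: "'a \<Rightarrow> nat" and k t :: nat and D :: real
  assumes fin: "finite (pverts \<Gamma>)"
    and adj: "\<And>u v. u \<in> pverts \<Gamma> \<Longrightarrow> v \<in> pverts \<Gamma> \<Longrightarrow> (u, v) \<in> parcs \<Gamma> \<longleftrightarrow> c u \<noteq> c v"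
    and c: "\<And>v. v \<in> pverts \<Gamma> \<Longrightarrow> c v \<le> k" and k: "k \<ge> 2" and t: "t \<ge> 1"
    and small: "\<And>l. l < k \<Longrightarrow> card {v \<in> pverts \<Gamma>. c v = l} = t"
    and large: "card {v \<in> pverts \<Gamma>. c v = k} = (k - 1) * t"
  defines "D \<equiv> sqrt ((real k - 1) * (5 * real k - 1))"
  shows spectrum_balanced_multipartite: "graph_spectrum \<Gamma> =
      replicate_mset ((2 * k - 1) * t - (k + 1)) 0 + replicate_mset (k - 1) (- real t) +
      {# real t * (real k - 1 + D) / 2, real t * (real k - 1 - D) / 2 #}" (is ?spec)
    and energy_balanced_multipartite: "graph_energy \<Gamma> = real t * (real k - 1 + D)" (is ?energy)
proof -
  obtain vs where vs: "set vs = pverts \<Gamma>" "distinct vs"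
    using finite_distinct_list[OF fin] by blast
  let ?n = "length vs"
  have mem: "vs ! i \<in> pverts \<Gamma>" if "i < ?n" for i
    using that vs(1) nth_mem by blast
  have A: "adjacency_mat \<Gamma> vs = mat ?n ?n (\<lambda>(i, j). if c (vs ! i) \<noteq> c (vs ! j) then 1 else 0)"
    unfolding adjacency_mat_def by (intro cong_mat) (auto simp: adj mem)
  have card: "card {i. i < ?n \<and> c (vs ! i) = l} = card {v \<in> pverts \<Gamma>. c v = l}" for l
  proof -
    have "card ((!) vs ` {i. i < ?n \<and> c (vs ! i) = l}) = card {i. i < ?n \<and> c (vs ! i) = l}"
      using vs(2) by (intro card_image) (auto simp: inj_on_def nth_eq_iff_index_eq)
    moreover have "(!) vs ` {i. i < ?n \<and> c (vs ! i) = l} = {v \<in> pverts \<Gamma>. c v = l}"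
      by (auto simp: vs(1)[symmetric] in_set_conv_nth)
    ultimately show ?thesis by (simp only:)
  qed
  have "char_poly (adjacency_mat \<Gamma> vs) =
      [:0, 1:] ^ ((2 * k - 1) * t - (k + 1)) * [:real t, 1:] ^ (k - 1) *
      ([:- (real t * (real k - 1 + D) / 2), 1:] * [:- (real t * (real k - 1 - D) / 2), 1:])"
    unfolding A D_def
    by (rule char_poly_balanced_multipartite) (use k t in \<open>auto simp: card small large c mem\<close>)
  then show spec: ?spec
    by (simp add: graph_spectrum_eq[OF vs(2,1)] proots_mult proots_power del: mult_pCons_left mult_pCons_right)
  have "(real k - 1)\<^sup>2 \<le> (real k - 1) * (5 * real k - 1)"
    using k unfolding power2_eq_square by (intro mult_left_mono) auto
  then have D: "real k - 1 \<le> D"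
    unfolding D_def by (rule real_le_rsqrt)
  have "\<bar>real t * (real k - 1 + D) / 2\<bar> = real t * (real k - 1 + D) / 2"
    using k D by (intro abs_of_nonneg) auto
  moreover have "\<bar>real t * (real k - 1 - D) / 2\<bar> = - (real t * (real k - 1 - D) / 2)"
    using D by (intro abs_of_nonpos) (auto simp: mult_nonneg_nonpos)
  ultimately show ?energy
    unfolding graph_energy_def spec using k by (simp add: of_nat_diff) (simp add: field_simps)
qed

section \<open>The non-commuting graph\<close>

lemma dvd_double_iff:
  fixes r :: nat and x :: int
  shows "int r dvd 2 * x \<longleftrightarrow> int (r div gcd r 2) dvd x"
proof (cases "even r")
  case True
  then obtain q where "r = 2 * q" by blast
  then show ?thesis by simp
next
  case False
  then have "coprime (int r) 2" by simp
  moreover from False have "gcd r 2 = 1" by (simp add: coprime_iff_gcd_eq_1[symmetric])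
  ultimately show ?thesis by (simp add: coprime_dvd_mult_right_iff)
qed

text \<open>
  The second exponents of \<open>u v\<close> and \<open>v u\<close> always agree. The first ones are \<open>i \<plusminus> i'\<close> and \<open>i' \<plusminus> i\<close>,
  and their difference is \<open>0\<close>, \<open>\<plusminus>2 i\<close>, \<open>\<plusminus>2 i'\<close> or \<open>2 (i - i')\<close> according to the parities of \<open>j\<close> and
  \<open>j'\<close>.
\<close>

lemma M_class_commute_iff:
  fixes r s :: nat
  defines "k \<equiv> r div gcd r 2"
  assumes "M_exps u = (i, j)" and "M_exps v = (i', j')"
  shows "M_class r s u \<otimes>\<^bsub>M_group r s\<^esub> M_class r s v =
      M_class r s v \<otimes>\<^bsub>M_group r s\<^esub> M_class r s u \<longleftrightarrow>
    (odd j \<longrightarrow> odd j' \<longrightarrow> [i = i'] (mod int k)) \<and>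
    (odd j \<longrightarrow> even j' \<longrightarrow> int k dvd i') \<and>
    (even j \<longrightarrow> odd j' \<longrightarrow> int k dvd i)"
proof -
  have "[i - i' = i' - i] (mod int r) \<longleftrightarrow> [i = i'] (mod int k)"
    using dvd_double_iff[of r "i - i'"] by (simp add: cong_iff_dvd_diff k_def algebra_simps)
  moreover have "[i - i' = i' + i] (mod int r) \<longleftrightarrow> int k dvd i'"
    using dvd_double_iff[of r "- i'"] by (simp add: cong_iff_dvd_diff k_def)
  moreover have "[i + i' = i' - i] (mod int r) \<longleftrightarrow> int k dvd i"
    using dvd_double_iff[of r i] by (simp add: cong_iff_dvd_diff k_def)
  ultimately show ?thesis
    by (auto simp: M_group_mult M_class_eq_iff M_exps_append assms(2,3) add.commute)
qed

text \<open>
  It is enough to commute with the two generators. Commuting with \<open>a\<close> forces \<open>j\<close> to be even because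
  \<open>r \<ge> 3\<close> does not divide \<open>2\<close>, and then commuting with \<open>b\<close> forces \<open>k\<close> to divide \<open>i\<close>.
\<close>

lemma M_class_center_iff:
  fixes r s :: nat
  defines "k \<equiv> r div gcd r 2"
  assumes "r \<ge> 3" and u: "M_exps u = (i, j)"
  shows "M_class r s u \<in> group_center (M_group r s) \<longleftrightarrow> even j \<and> int k dvd i"
proof
  assume "M_class r s u \<in> group_center (M_group r s)"
  then have comm: "M_class r s u \<otimes>\<^bsub>M_group r s\<^esub> M_class r s v =
      M_class r s v \<otimes>\<^bsub>M_group r s\<^esub> M_class r s u" for v
    by (auto simp: group_center_def M_group_carrier)
  have "\<not> int r dvd 2"
    using \<open>r \<ge> 3\<close> by (auto dest: zdvd_imp_le)
  then have "\<not> int k dvd 1"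
    using dvd_double_iff[of r 1] by (simp add: k_def)
  then have "even j"
    using comm[of "[Gen gen_a]"] M_class_commute_iff[OF u, of "[Gen gen_a]" 1 0 r s]
    by (auto simp: k_def)
  moreover from this have "int k dvd i"
    using comm[of "[Gen gen_b]"] M_class_commute_iff[OF u, of "[Gen gen_b]" 0 1 r s]
    by (auto simp: k_def)
  ultimately show "even j \<and> int k dvd i" ..
next
  assume "even j \<and> int k dvd i"
  then show "M_class r s u \<in> group_center (M_group r s)"
    using M_class_commute_iff[OF u prod.collapse[symmetric], of r s]
    by (auto simp: group_center_def M_group_carrier k_def)
qed

lemma bij_betw_M_group:
  assumes "r > 0" and "s > 0"
  shows "bij_betw (\<lambda>(i, j). M_class r s (replicate i (Gen gen_a) @ replicate j (Gen gen_b)))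
    ({..<r} \<times> {..<2 * s}) (carrier (M_group r s))"
    (is "bij_betw ?f _ _")
proof (rule bij_betwI')
  show "?f p = ?f q \<longleftrightarrow> p = q" if "p \<in> {..<r} \<times> {..<2 * s}" "q \<in> {..<r} \<times> {..<2 * s}" for p q
  proof -
    obtain i j i' j' where p: "p = (i, j)" and q: "q = (i', j')" by (metis surj_pair)
    have "?f p = ?f q \<longleftrightarrow> [i = i'] (mod r) \<and> [j = j'] (mod 2 * s)"
      using cong_int_iff[of j j' "2 * s"]
      by (simp add: p q M_class_eq_iff M_exps_append M_exps_replicate cong_int_iff)
    also have "\<dots> \<longleftrightarrow> p = q"
      using that by (auto simp: p q intro: cong_less_modulus_unique_nat)
    finally show ?thesis .
  qed
  show "?f p \<in> carrier (M_group r s)" if "p \<in> {..<r} \<times> {..<2 * s}" for p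
    by (auto simp: M_group_carrier split: prod.split)
  show "\<exists>p\<in>{..<r} \<times> {..<2 * s}. X = ?f p" if X: "X \<in> carrier (M_group r s)" for X
  proof -
    obtain w where w: "X = M_class r s w" using X unfolding M_group_carrier by blast
    let ?i = "nat (fst (M_exps w) mod int r)" and ?j = "nat (snd (M_exps w) mod (2 * int s))"
    have "X = ?f (?i, ?j)"
      using assms by (simp add: w M_class_eq_iff M_exps_append M_exps_replicate cong_def)
    moreover have "(?i, ?j) \<in> {..<r} \<times> {..<2 * s}"
      using assms by (simp add: nat_less_iff)
    ultimately show ?thesis by blast
  qed
qed

lemma card_less_mod_eq:
  assumes "l < k"
  shows "card {i. i < m * k \<and> i mod k = l} = (m :: nat)"
proof -
  have "{i. i < m * k \<and> i mod k = l} = (\<lambda>q. q * k + l) ` {..<m}"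
  proof (intro equalityI subsetI)
    fix i assume "i \<in> {i. i < m * k \<and> i mod k = l}"
    then have "i = i div k * k + l" "i div k < m"
      using assms by (auto simp: less_mult_imp_div_less)
    then show "i \<in> (\<lambda>q. q * k + l) ` {..<m}" by blast
  next
    fix i assume "i \<in> (\<lambda>q. q * k + l) ` {..<m}"
    then obtain q where q: "q < m" "i = q * k + l" by blast
    then have "i < Suc q * k" using assms by simp
    also have "\<dots> \<le> m * k" using q(1) by (intro mult_le_mono1) simp
    finally show "i \<in> {i. i < m * k \<and> i mod k = l}" using q assms by simp
  qed
  moreover have "inj_on (\<lambda>q. q * k + l) {..<m}"
    using assms by (auto simp: inj_on_def)
  ultimately show ?thesis by (simp add: card_image)
qed

text \<open>
  The parts are described by the colouring that sends \<open>a\<^sup>i b\<^sup>j\<close> to \<open>i mod k\<close> if \<open>j\<close> is odd and to the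
  extra colour \<open>k\<close> if \<open>j\<close> is even. Among the exponents \<open>i < r\<close> and \<open>j < 2 s\<close>, a colour \<open>l < k\<close>
  is taken by \<open>gcd r 2\<close> values of \<open>i\<close> and \<open>s\<close> values of \<open>j\<close>. The colour \<open>k\<close> is taken by the \<open>s\<close> even values
  of \<open>j\<close> together with the \<open>r - gcd r 2\<close> values of \<open>i\<close> that \<open>k\<close> does not divide; the others are central.
\<close>

lemma
  fixes r s :: nat and D :: real
  assumes r: "r \<ge> 3" and s: "s \<ge> 1"
  defines "k \<equiv> r div gcd r 2" and "t \<equiv> s * gcd r 2"
  defines "D \<equiv> sqrt ((real k - 1) * (5 * real k - 1))"
  shows spectrum_noncommuting_M_group: "graph_spectrum (noncommuting_graph (M_group r s)) =
      replicate_mset ((2 * k - 1) * t - (k + 1)) 0 + replicate_mset (k - 1) (- real t) +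
      {# real t * (real k - 1 + D) / 2, real t * (real k - 1 - D) / 2 #}"
    and energy_noncommuting_M_group: "graph_energy (noncommuting_graph (M_group r s)) =
      real t * (real k - 1 + D)"
proof -
  define \<Gamma> where "\<Gamma> = noncommuting_graph (M_group r s)"
  define m where "m = gcd r 2"
  have rk: "r = m * k" by (simp add: k_def m_def)
  have m: "m > 0" using r by (simp add: m_def)
  have k: "k \<ge> 2"
  proof (cases "even r")
    case True
    then show ?thesis using r by (auto simp: k_def elim!: evenE)
  next
    case False
    then have "gcd r 2 = 1" by (simp add: coprime_iff_gcd_eq_1[symmetric])
    then show ?thesis using r by (simp add: k_def)
  qed
  define col where "col = (\<lambda>(i :: int, j :: int). if odd j then nat (i mod int k) else k)"
  \<comment> \<open>Elements are classes of words, so the colour is read off from an arbitrary representative.\<close>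
  define c where "c = (\<lambda>X. col (M_exps (SOME w. M_class r s w = X)))"
  have c_class: "c (M_class r s w) = col (M_exps w)" for w
  proof -
    define w' where "w' = (SOME w'. M_class r s w' = M_class r s w)"
    have "M_class r s w' = M_class r s w"
      unfolding w'_def by (rule someI) (rule HOL.refl)
    then have "[fst (M_exps w') = fst (M_exps w)] (mod int k)"
      and "[snd (M_exps w') = snd (M_exps w)] (mod 2)"
      unfolding M_class_eq_iff by (auto simp: rk intro: cong_dvd_modulus)
    then have "fst (M_exps w') mod int k = fst (M_exps w) mod int k"
      and "even (snd (M_exps w')) \<longleftrightarrow> even (snd (M_exps w))"
      by (simp_all add: cong_def even_iff_mod_2_eq_zero)
    then show ?thesis
      unfolding c_def w'_def[symmetric] by (simp add: col_def case_prod_beta)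
  qed
  have verts: "M_class r s w \<in> pverts \<Gamma> \<longleftrightarrow> odd (snd (M_exps w)) \<or> \<not> int k dvd fst (M_exps w)" for w
    using M_class_center_iff[OF r, of w "fst (M_exps w)" "snd (M_exps w)" s]
    by (auto simp: \<Gamma>_def noncommuting_graph_def M_group_carrier k_def)
  have vertE: "\<exists>w. X = M_class r s w" if "X \<in> pverts \<Gamma>" for X
    using that by (auto simp: \<Gamma>_def noncommuting_graph_def M_group_carrier)
  define f where "f = (\<lambda>(i, j). M_class r s (replicate i (Gen gen_a) @ replicate j (Gen gen_b)))"
  have bij: "bij_betw f ({..<r} \<times> {..<2 * s}) (carrier (M_group r s))"
    unfolding f_def using r s by (intro bij_betw_M_group) auto
  have vf: "f (i, j) \<in> pverts \<Gamma> \<longleftrightarrow> odd j \<or> \<not> k dvd i" 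
    and cf: "c (f (i, j)) = (if odd j then i mod k else k)" for i j
    by (simp_all add: f_def verts c_class M_exps_append M_exps_replicate col_def
        nat_mod_as_int)
  have fibre: "card {X \<in> pverts \<Gamma>. c X = l} =
      card {p \<in> {..<r} \<times> {..<2 * s}. f p \<in> pverts \<Gamma> \<and> c (f p) = l}" for l
  proof -
    have "pverts \<Gamma> \<subseteq> f ` ({..<r} \<times> {..<2 * s})"
      using bij by (auto simp: bij_betw_def \<Gamma>_def noncommuting_graph_def)
    then have "{X \<in> pverts \<Gamma>. c X = l} =
        f ` {p \<in> {..<r} \<times> {..<2 * s}. f p \<in> pverts \<Gamma> \<and> c (f p) = l}"
      by blast
    moreover have "inj_on f {p \<in> {..<r} \<times> {..<2 * s}. f p \<in> pverts \<Gamma> \<and> c (f p) = l}"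
      using bij by (auto simp: bij_betw_def intro: inj_on_subset)
    ultimately show ?thesis by (simp add: card_image)
  qed
  have adj: "(X, Y) \<in> parcs \<Gamma> \<longleftrightarrow> c X \<noteq> c Y" if XY: "X \<in> pverts \<Gamma>" "Y \<in> pverts \<Gamma>" for X Y
  proof -
    obtain u v where uv: "X = M_class r s u" "Y = M_class r s v"
      using XY vertE by blast
    obtain i j i' j' where e: "M_exps u = (i, j)" "M_exps v = (i', j')"
      by (metis surj_pair)
    have "nat (x mod int k) < k" for x
      using k by (simp add: nat_less_iff)
    then have ne: "nat (x mod int k) \<noteq> k" for x
      by (metis less_irrefl)
    have "(X, Y) \<in> parcs \<Gamma> \<longleftrightarrow>
        X \<otimes>\<^bsub>M_group r s\<^esub> Y \<noteq> Y \<otimes>\<^bsub>M_group r s\<^esub> X"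
      using XY by (auto simp: \<Gamma>_def noncommuting_graph_def)
    also have "\<dots> \<longleftrightarrow> col (i, j) \<noteq> col (i', j')"
      using XY k ne ne[symmetric] unfolding uv M_class_commute_iff[OF e] verts e k_def[symmetric]
      by (auto simp: col_def cong_def eq_nat_nat_iff)
    finally show ?thesis by (simp add: uv c_class e)
  qed
  have odds: "card {j. j < 2 * s \<and> odd j} = s" and evens: "card {j. j < 2 * s \<and> even j} = s"
    using card_less_mod_eq[of 1 2 s] card_less_mod_eq[of 0 2 s]
    by (simp_all add: odd_iff_mod_2_eq_one even_iff_mod_2_eq_zero mult.commute)
  have small: "card {X \<in> pverts \<Gamma>. c X = l} = t" if l: "l < k" for l
  proof -
    have "{p \<in> {..<r} \<times> {..<2 * s}. f p \<in> pverts \<Gamma> \<and> c (f p) = l} =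
        {i. i < m * k \<and> i mod k = l} \<times> {j. j < 2 * s \<and> odd j}"
      using l by (auto simp: vf cf rk[symmetric] split: if_splits)
    then show ?thesis
      unfolding fibre
      by (simp only: card_cartesian_product card_less_mod_eq[OF l] odds) (simp add: t_def m_def)
  qed
  have large: "card {X \<in> pverts \<Gamma>. c X = k} = (k - 1) * t"
  proof -
    have "i mod k < k" for i using k by simp
    then have "i mod k \<noteq> k" for i by (metis less_irrefl)
    then have "f (i, j) \<in> pverts \<Gamma> \<and> c (f (i, j)) = k \<longleftrightarrow> \<not> k dvd i \<and> even j" for i j
      unfolding vf cf by (cases "odd j") simp_all
    then have "{p \<in> {..<r} \<times> {..<2 * s}. f p \<in> pverts \<Gamma> \<and> c (f p) = k} =
        ({..<r} - {i. i < r \<and> k dvd i}) \<times> {j. j < 2 * s \<and> even j}"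
      by auto
    moreover have "card {i. i < r \<and> k dvd i} = m"
      using card_less_mod_eq[of 0 k m] k by (simp add: mod_eq_0_iff_dvd rk[symmetric])
    then have "card ({..<r} - {i. i < r \<and> k dvd i}) = r - m"
      by (subst card_Diff_subset) auto
    ultimately show ?thesis
      unfolding fibre
      by (simp add: card_cartesian_product evens t_def m_def[symmetric])
        (simp add: rk diff_mult_distrib algebra_simps)
  qed
  have fin: "finite (pverts \<Gamma>)"
    using bij_betw_finite[OF bij] by (auto simp: \<Gamma>_def noncommuting_graph_def)
  have le: "c X \<le> k" if X: "X \<in> pverts \<Gamma>" for X
  proof -
    have "nat (x mod int k) \<le> k" for x
      using k by (simp add: nat_le_iff less_imp_le)
    then show ?thesis
      using vertE[OF X] by (auto simp: c_class col_def split: prod.split)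
  qed
  have t: "t \<ge> 1" using s m by (simp add: t_def m_def Suc_leI)
  note balanced = fin adj le k t small large
  show "graph_spectrum (noncommuting_graph (M_group r s)) =
      replicate_mset ((2 * k - 1) * t - (k + 1)) 0 + replicate_mset (k - 1) (- real t) +
      {# real t * (real k - 1 + D) / 2, real t * (real k - 1 - D) / 2 #}"
    unfolding D_def \<Gamma>_def[symmetric] by (rule spectrum_balanced_multipartite[OF balanced])
  show "graph_energy (noncommuting_graph (M_group r s)) = real t * (real k - 1 + D)"
    unfolding D_def \<Gamma>_def[symmetric] by (rule energy_balanced_multipartite[OF balanced])
qed

section \<open>The spectrum and the energy\<close>

theorem corollary2p6:
  fixes r s :: nat
  assumes "r \<ge> 3" and "s \<ge> 1"
  shows
    "(odd r \<longrightarrow>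
       graph_spectrum (noncommuting_graph (M_group r s)) =
         replicate_mset (2 * s * r - s - r - 1) 0 +
         replicate_mset (r - 1) (- real s) +
         {# (real s * (real r - 1) + real s * sqrt ((real r - 1) * (5 * real r - 1))) / 2,
            (real s * (real r - 1) - real s * sqrt ((real r - 1) * (5 * real r - 1))) / 2 #} \<and>
       graph_energy (noncommuting_graph (M_group r s)) =
         real s * ((real r - 1) + sqrt ((real r - 1) * (5 * real r - 1)))) \<and>
     (even r \<longrightarrow>
       graph_spectrum (noncommuting_graph (M_group r s)) =
         replicate_mset (2 * s * r - 2 * s - r div 2 - 1) 0 +
         replicate_mset (r div 2 - 1) (- 2 * real s) +
         {# real s * (real r / 2 - 1) + real s * sqrt ((real r / 2 - 1) * (5 * real r / 2 - 1)),
            real s * (real r / 2 - 1) - real s * sqrt ((real r / 2 - 1) * (5 * real r / 2 - 1)) #} \<and>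
       graph_energy (noncommuting_graph (M_group r s)) =
         real s * ((real r - 2) + sqrt ((real r - 2) * (5 * real r - 2))))"
proof (intro conjI impI)
  let ?\<Gamma> = "noncommuting_graph (M_group r s)"
  note spec = spectrum_noncommuting_M_group[OF assms]
    and energy = energy_noncommuting_M_group[OF assms]
  {
    assume "odd r"
    then have gcd: "gcd r 2 = 1" by (simp add: coprime_iff_gcd_eq_1[symmetric])
    have mult: "(2 * r - 1) * s - (r + 1) = 2 * s * r - s - r - 1"
      by (simp add: diff_mult_distrib algebra_simps)
    let ?D = "sqrt ((real r - 1) * (5 * real r - 1))"
    show "graph_spectrum ?\<Gamma> =
        replicate_mset (2 * s * r - s - r - 1) 0 + replicate_mset (r - 1) (- real s) +
        {# (real s * (real r - 1) + real s * ?D) / 2, (real s * (real r - 1) - real s * ?D) / 2 #}"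
      using spec unfolding gcd by (simp only: mult div_by_1 mult_1_right distrib_left right_diff_distrib)
    show "graph_energy ?\<Gamma> = real s * ((real r - 1) + ?D)"
      using energy unfolding gcd by simp
  }
  {
    assume "even r"
    then obtain q where q: "r = 2 * q" by blast
    then have gcd: "gcd r 2 = 2" and div: "r div 2 = q" by simp_all
    have half: "real q = real r / 2" using q by simp
    have mult: "(2 * q - 1) * (s * 2) - (q + 1) = 2 * s * r - 2 * s - q - 1"
      by (simp add: q diff_mult_distrib algebra_simps)
    let ?D = "sqrt ((real r / 2 - 1) * (5 * real r / 2 - 1))"
    have D: "sqrt ((real r / 2 - 1) * (5 * (real r / 2) - 1)) = ?D" by simp
    have dbl: "real (s * 2) * x / 2 = real s * x" "- real (s * 2) = - 2 * real s" for x by simp_all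
    show "graph_spectrum ?\<Gamma> =
        replicate_mset (2 * s * r - 2 * s - r div 2 - 1) 0 +
        replicate_mset (r div 2 - 1) (- 2 * real s) +
        {# real s * (real r / 2 - 1) + real s * ?D, real s * (real r / 2 - 1) - real s * ?D #}"
      using spec unfolding gcd div half D
      by (simp only: mult dbl distrib_left[of "real s" "_ - _"] right_diff_distrib[of "real s" _ "sqrt _"])
    have "2 * ?D = sqrt ((real r - 2) * (5 * real r - 2))"
    proof -
      have "2 * ?D = sqrt (2\<^sup>2 * ((real r / 2 - 1) * (5 * real r / 2 - 1)))"
        by (simp only: real_sqrt_mult real_sqrt_abs abs_numeral)
      also have "2\<^sup>2 * ((real r / 2 - 1) * (5 * real r / 2 - 1)) = (real r - 2) * (5 * real r - 2)"
        by (simp add: field_simps)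
      finally show ?thesis .
    qed
    then have "real s * ((real r - 2) + sqrt ((real r - 2) * (5 * real r - 2))) =
        real s * ((real r - 2) + 2 * ?D)" by simp
    also have "\<dots> = real (s * 2) * (real r / 2 - 1 + ?D)"
      by (simp add: algebra_simps)
    finally show "graph_energy ?\<Gamma> = real s * ((real r - 2) + sqrt ((real r - 2) * (5 * real r - 2)))"
      using energy unfolding gcd div half D by (simp only:)
  }
qed

end
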